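(* Let $b,\iota>0$, let $\sigma$ be a fixed parameter, and let $n\ge 0$ be an integer. Let $\mathcal Q^{(0)}_{n,1}(x)$ and $\mathcal Q^{(0)}_{n,-1}(x)$ be the polynomials $$\mathcal Q^{(0)}_{n,1}(x)=\frac{(\sigma_0+1)_n}{n!}\;{}_4F_3\!\left(-n,\;n+\sigma_0+\delta_0+1,\;\tfrac{\sigma-\rho+x}{2},\;\tfrac{\sigma-\rho-x}{2};\;\sigma_0+1,\;\tfrac{\sigma+1-\iota}{2},\;\tfrac{\sigma}{2};\;1\right),$$ $$\mathcal Q^{(0)}_{n,-1}(x)=\frac{(\sigma_0+1)_n}{n!\,(-\sigma)}\,(\rho+x)\;{}_4F_3\!\left(-n,\;n+\sigma_0+\delta_1+1,\;\tfrac{\sigma-\rho+x}{2},\;\tfrac{\sigma-\rho-x}{2};\;\sigma_0+1,\;\tfrac{\sigma+1-\iota}{2},\;\tfrac{\sigma}{2}+1;\;1\right).$$ Then the following Rodrigues type formulas hold: $$Q^{(0)}_{n,1}(t)=\mathcal Q^{(0)}_{n,1}(D)\,w_\sigma(t),\qquad Q^{(0)}_{n,-1}(t)=\mathcal Q^{(0)}_{n,-1}(D)\,w_\sigma(t).$$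
   Context: Put $\rho=b+\iota$. The Cherednik operator, acting on smooth functions on $\mathbb R$, is $$D=\frac{d}{dt}+2\iota\,\frac{1}{1-e^{-4t}}(1-s)+2b\,\frac{1}{1-e^{-2t}}(1-s)-\rho,\qquad (sf)(t)=f(-t).$$ For a polynomial $p$, $p(D)$ is the corresponding polynomial in the operator $D$. Put $w_\sigma(t)=(\cosh t)^{-\sigma}$, and $$\sigma_0=\sigma-(\iota+b+1),\qquad \delta_0=\frac{\iota-1}{2}+b,\qquad \delta_1=\delta_0+1=\frac{\iota+1}{2}+b .$$ The hypergeometric series is ${}_pF_q(a_1,\dots,a_p;b_1,\dots,b_q;x)=\sum_{m\ge0}\frac{(a_1)_m\cdots(a_p)_m}{(b_1)_m\cdots(b_q)_m}\frac{x^m}{m!}$ with $(a)_m=a(a+1)\cdots(a+m-1)$. $P_n^{\alpha,\beta}$ denotes the Jacobi polynomial in the standard normalization $P_n^{\alpha,\beta}(1)=\frac{(\alpha+1)_n}{n!}$, orthogonal on $(-1,1)$ with respect to $(1-x)^\alpha(1+x)^\beta dx$. The Jacobi type functions (with $k=0$) are $$Q^{(0)}_{n,1}(t)=w_\sigma(t)\,P_n^{\sigma_0,\delta_0}(2\tanh^2t-1),\qquad Q^{(0)}_{n,-1}(t)=w_\sigma(t)\,P_n^{\sigma_0,\delta_1}(2\tanh^2t-1)\,\tanh t .$$ *)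

theory Defs
  imports "HOL-Analysis.Analysis" "HOL-Computational_Algebra.Polynomial"
begin

section \<open>Hypergeometric series\<close>

definition hypergeom :: "complex list \<Rightarrow> complex list \<Rightarrow> complex \<Rightarrow> complex" where
  "hypergeom as bs x =
     (\<Sum>m. (\<Prod>a\<leftarrow>as. pochhammer a m) / (\<Prod>b\<leftarrow>bs. pochhammer b m) * x ^ m / fact m)"

section \<open>Jacobi polynomials\<close>

text \<open>
  The explicit formula
  \<open>\<Sum>s. (n+\<alpha> choose n-s) (n+\<beta> choose s) ((x-1)/2)^s ((x+1)/2)^(n-s)\<close>
  makes sense for all parameters.  For real \<open>\<alpha>, \<beta> > -1\<close> the theorem
  \<open>jacobi_poly_iff\<close> below shows that it is the unique polynomial of degree at most \<open>n\<close> that is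
  orthogonal to all polynomials of lower degree with respect to \<open>(1-x)^\<alpha> (1+x)^\<beta> dx\<close> on
  \<open>(-1,1)\<close> and takes the value \<open>(\<alpha>+1)_n / n!\<close> at \<open>1\<close>.
\<close>

definition jacobi_poly :: "nat \<Rightarrow> 'a :: field_char_0 \<Rightarrow> 'a \<Rightarrow> 'a poly" where
  "jacobi_poly n \<alpha> \<beta> =
     (\<Sum>s\<le>n. smult (((of_nat n + \<alpha>) gchoose (n - s)) * ((of_nat n + \<beta>) gchoose s))
              ([:-1/2, 1/2:] ^ s * [:1/2, 1/2:] ^ (n - s)))"

lemma poly_jacobi_poly:
  "poly (jacobi_poly n \<alpha> \<beta>) x =
     (\<Sum>s\<le>n. ((of_nat n + \<alpha>) gchoose (n - s)) * ((of_nat n + \<beta>) gchoose s) *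
              (((x - 1) / 2) ^ s * ((x + 1) / 2) ^ (n - s)))"
  unfolding jacobi_poly_def poly_sum
  by (intro sum.cong refl) (simp add: poly_power field_simps)

lemma degree_jacobi_poly_le: "degree (jacobi_poly n \<alpha> \<beta>) \<le> n"
  unfolding jacobi_poly_def
proof (intro degree_sum_le)
  fix s assume s: "s \<in> {..n}"
  have "degree (([:-1/2, 1/2:] :: 'a poly) ^ s * [:1/2, 1/2:] ^ (n - s)) \<le> s + (n - s)"
    by (intro order.trans[OF degree_mult_le] add_mono order.trans[OF degree_power_le]) auto
  then show "degree (smult (((of_nat n + \<alpha>) gchoose (n - s)) * ((of_nat n + \<beta>) gchoose s))
              ([:-1/2, 1/2:] ^ s * [:1/2, 1/2:] ^ (n - s))) \<le> n"
    using s by (intro order.trans[OF degree_smult_le]) auto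
qed simp

lemma jacobi_poly_at_1: "poly (jacobi_poly n \<alpha> \<beta>) 1 = pochhammer (\<alpha> + 1) n / fact n"
proof -
  have "poly (jacobi_poly n \<alpha> \<beta>) 1 =
     (\<Sum>s\<in>{0}. ((of_nat n + \<alpha>) gchoose (n - s)) * ((of_nat n + \<beta>) gchoose s) *
              (((1 - 1) / 2) ^ s * ((1 + 1) / 2) ^ (n - s)))"
    unfolding poly_jacobi_poly by (intro sum.mono_neutral_right) auto
  then show ?thesis by (simp add: gbinomial_pochhammer')
qed

lemma of_real_poly_jacobi_poly:
  fixes \<alpha> \<beta> x :: real
  shows "(of_real (poly (jacobi_poly n \<alpha> \<beta>) x) :: complex) =
           poly (jacobi_poly n (of_real \<alpha>) (of_real \<beta>)) (of_real x)"
proof -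
  have "of_real (a gchoose k) = ((of_real a :: complex) gchoose k)" for a :: real and k
    by (simp add: gbinomial_prod_rev)
  then show ?thesis by (simp add: poly_jacobi_poly)
qed

lemma alternating_binomial_pochhammer_sum:
  fixes c :: real
  assumes "k < n"
  shows "(\<Sum>s\<le>n. (-1) ^ s * of_nat (n choose s) * pochhammer (c - of_nat s) k) = 0"
  using assms
proof (induction n arbitrary: k c)
  case (Suc n)
  define F where "F = (\<lambda>n k c. \<Sum>s\<le>n. (-1) ^ s * real (n choose s) * pochhammer (c - real s) k)"
  have "F (Suc n) k c = pochhammer c k +
     (\<Sum>s\<le>n. (-1) ^ Suc s * real (Suc n choose Suc s) * pochhammer (c - real (Suc s)) k)"
    unfolding F_def by (subst sum.atMost_Suc_shift) simp
  also have "(\<Sum>s\<le>n. (-1) ^ Suc s * real (Suc n choose Suc s) * pochhammer (c - real (Suc s)) k) =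
     (\<Sum>s\<le>n. (-1) ^ Suc s * real (n choose Suc s) * pochhammer (c - real (Suc s)) k)
     - F n k (c - 1)"
    unfolding F_def sum_subtractf[symmetric]
    by (intro sum.cong refl) (simp add: algebra_simps)
  also have "pochhammer c k + ((\<Sum>s\<le>n. (-1) ^ Suc s * real (n choose Suc s) * pochhammer (c - real (Suc s)) k)
     - F n k (c - 1)) = (\<Sum>s\<le>Suc n. (-1) ^ s * real (n choose s) * pochhammer (c - real s) k) - F n k (c - 1)"
    by (subst sum.atMost_Suc_shift) simp
  also have "(\<Sum>s\<le>Suc n. (-1) ^ s * real (n choose s) * pochhammer (c - real s) k) = F n k c"
    unfolding F_def by simp
  finally have *: "F (Suc n) k c = F n k c - F n k (c - 1)" .
  show ?case
  proof (cases k)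
    case 0
    then show ?thesis using * by (simp add: F_def)
  next
    case (Suc j)
    have p: "pochhammer y (Suc j) - pochhammer (y - 1) (Suc j) = real (Suc j) * pochhammer y j"
      for y :: real
      using pochhammer_rec[of "y - 1" j] pochhammer_Suc[of y j] by (simp add: algebra_simps)
    have "F n k c - F n k (c - 1) = (\<Sum>s\<le>n. (-1) ^ s * real (n choose s) *
        (pochhammer (c - real s) (Suc j) - pochhammer (c - real s - 1) (Suc j)))"
      unfolding F_def Suc sum_subtractf[symmetric]
      by (intro sum.cong refl) (simp add: algebra_simps)
    also have "\<dots> = real (Suc j) * F n j c"
      unfolding p F_def sum_distrib_left by (intro sum.cong refl) simp
    also have "F n j c = 0" using Suc Suc.IH[of j c] Suc.prems by (simp add: F_def)
    finally show ?thesis using * by (simp add: F_def)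
  qed
qed simp

lemma jacobi_poly_orthogonal_aux:
  fixes \<alpha> \<beta> :: real
  assumes ab: "\<alpha> > -1" "\<beta> > -1" and k: "k < n"
  shows "((\<lambda>v. (1 - v) powr \<alpha> * v powr \<beta> * poly (jacobi_poly n \<alpha> \<beta>) (2 * v - 1) * v ^ k)
           has_integral 0) {0..1}"
proof -
  define C where "C s = ((real n + \<alpha>) gchoose (n - s)) * ((real n + \<beta>) gchoose s)" for s
  define B where "B s = Beta (\<beta> + real (n - s + k) + 1) (\<alpha> + real s + 1)" for s
  have "((\<lambda>v. \<Sum>s\<le>n. C s * (-1) ^ s * (v powr (\<beta> + real (n - s + k) + 1 - 1) *
            (1 - v) powr (\<alpha> + real s + 1 - 1))) has_integral (\<Sum>s\<le>n. C s * (-1) ^ s * B s)) {0..1}"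
    unfolding B_def using ab
    by (intro has_integral_sum has_integral_mult_right has_integral_Beta_real) auto
  moreover have "(\<Sum>s\<le>n. C s * (-1) ^ s * B s) = 0"
  proof -
    have "C s * (-1) ^ s * B s =
        Gamma (\<alpha> + n + 1) * Gamma (\<beta> + n + 1) / (Gamma (\<alpha> + \<beta> + n + k + 2) * fact n) *
        ((-1) ^ s * real (n choose s) * pochhammer (\<beta> + n + 1 - real s) k)" if s: "s \<le> n" for s
    proof -
      have np: "x \<notin> \<int>\<^sub>\<le>\<^sub>0" if "x > 0" for x :: real
        using that by (auto elim!: nonpos_Ints_cases)
      have pos: "\<alpha> + real s + 1 > 0" "\<beta> + n - real s + 1 > 0" using ab s by auto
      have c1: "((real n + \<alpha>) gchoose (n - s)) = Gamma (\<alpha> + n + 1) / Gamma (\<alpha> + real s + 1) / fact (n - s)"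
        using s pochhammer_Gamma[OF np[OF pos(1)], of "n - s"]
        by (simp add: gbinomial_pochhammer' of_nat_diff algebra_simps)
      have c2: "((real n + \<beta>) gchoose s) = Gamma (\<beta> + n + 1) / Gamma (\<beta> + n - real s + 1) / fact s"
        using s pochhammer_Gamma[OF np[OF pos(2)], of s]
        by (simp add: gbinomial_pochhammer' algebra_simps)
      have c3: "pochhammer (\<beta> + n + 1 - real s) k =
          Gamma (\<beta> + real (n - s + k) + 1) / Gamma (\<beta> + n - real s + 1)"
        using s pochhammer_Gamma[OF np[OF pos(2)], of k] by (simp add: of_nat_diff algebra_simps)
      have c4: "B s = Gamma (\<beta> + real (n - s + k) + 1) * Gamma (\<alpha> + real s + 1) /
          Gamma (\<alpha> + \<beta> + n + k + 2)"
        using s by (simp add: B_def Beta_def of_nat_diff algebra_simps)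
      have c5: "real (n choose s) = fact n / (fact s * fact (n - s))"
        using s by (rule binomial_fact)
      have g: "Gamma (\<alpha> + real s + 1) \<noteq> 0" "Gamma (\<beta> + n - real s + 1) \<noteq> 0"
        using Gamma_real_pos[OF pos(1)] Gamma_real_pos[OF pos(2)] by auto
      show ?thesis
        unfolding C_def c1 c2 c3 c4 c5 using g by (simp add: field_simps)
    qed
    then have "(\<Sum>s\<le>n. C s * (-1) ^ s * B s) =
        Gamma (\<alpha> + n + 1) * Gamma (\<beta> + n + 1) / (Gamma (\<alpha> + \<beta> + n + k + 2) * fact n) *
        (\<Sum>s\<le>n. (-1) ^ s * real (n choose s) * pochhammer (\<beta> + n + 1 - real s) k)"
      unfolding sum_distrib_left by (intro sum.cong refl) auto
    then show ?thesis using alternating_binomial_pochhammer_sum[OF k, of "\<beta> + n + 1"] by simp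
  qed
  ultimately have I: "((\<lambda>v. \<Sum>s\<le>n. C s * (-1) ^ s * (v powr (\<beta> + real (n - s + k) + 1 - 1) *
            (1 - v) powr (\<alpha> + real s + 1 - 1))) has_integral 0) (cbox 0 1)" by simp
  have "(1 - v) powr \<alpha> * v powr \<beta> * poly (jacobi_poly n \<alpha> \<beta>) (2 * v - 1) * v ^ k =
     (\<Sum>s\<le>n. C s * (-1) ^ s * (v powr (\<beta> + real (n - s + k) + 1 - 1) *
            (1 - v) powr (\<alpha> + real s + 1 - 1)))" if v: "v \<in> box 0 1" for v :: real
  proof -
    have v01: "v > 0" "1 - v > 0" using v by auto
    have e: "(2 * v - 1 - 1) / 2 = (-1) * (1 - v)" "(2 * v - 1 + 1) / 2 = v" by auto
    have p: "v powr (\<beta> + real (n - s + k) + 1 - 1) = v powr \<beta> * v ^ (n - s) * v ^ k"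
      "(1 - v) powr (\<alpha> + real s + 1 - 1) = (1 - v) powr \<alpha> * (1 - v) ^ s" for s
      using v01 powr_add[of v \<beta> "real (n - s + k)"] powr_realpow[of v "n - s + k"]
        powr_add[of "1 - v" \<alpha> "real s"] powr_realpow[of "1 - v" s]
      by (simp_all add: power_add del: of_nat_add)
    show ?thesis
      unfolding poly_jacobi_poly sum_distrib_left sum_distrib_right C_def e power_mult_distrib p
      by (intro sum.cong refl) (simp only: mult_ac)
  qed
  from has_integral_spike_interior[OF I this] show ?thesis by simp
qed

lemma jacobi_poly_orthogonal:
  fixes \<alpha> \<beta> :: real
  assumes ab: "\<alpha> > -1" "\<beta> > -1" and q: "degree q < n"
  shows "((\<lambda>x. (1 - x) powr \<alpha> * (1 + x) powr \<beta> * poly (jacobi_poly n \<alpha> \<beta>) x * poly q x)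
           has_integral 0) {-1..1}"
proof -
  define r where "r = pcompose q [:-1, 2:]"
  have r: "degree r < n" using q by (simp add: r_def degree_pcompose)
  let ?W = "\<lambda>v. (1 - v) powr \<alpha> * v powr \<beta> * poly (jacobi_poly n \<alpha> \<beta>) (2 * v - 1)"
  have "((\<lambda>v. \<Sum>k\<le>degree r. coeff r k * (?W v * v ^ k)) has_integral (\<Sum>k\<le>degree r. coeff r k * 0)) {0..1}"
    using r by (intro has_integral_sum has_integral_mult_right jacobi_poly_orthogonal_aux ab) auto
  also have "(\<lambda>v. \<Sum>k\<le>degree r. coeff r k * (?W v * v ^ k)) = (\<lambda>v. ?W v * poly r v)"
  proof
    fix v
    have "(\<Sum>k\<le>degree r. coeff r k * (y * v ^ k)) = y * poly r v" for y
      unfolding poly_altdef sum_distrib_left by (intro sum.cong refl) (simp only: mult_ac)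
    then show "(\<Sum>k\<le>degree r. coeff r k * (?W v * v ^ k)) = ?W v * poly r v" .
  qed
  finally have I: "((\<lambda>v. ?W v * poly r v) has_integral 0) (cbox 0 1)" by simp
  have "((\<lambda>x. ?W ((1/2) *\<^sub>R x + 1/2) * poly r ((1/2) *\<^sub>R x + 1/2)) has_integral 0) {-1..1}"
    using has_integral_affinity'[OF I, of "1/2" "1/2"] by simp
  then have J: "((\<lambda>x. 2 powr (\<alpha> + \<beta>) * (?W ((1/2) *\<^sub>R x + 1/2) * poly r ((1/2) *\<^sub>R x + 1/2)))
      has_integral 0) (cbox (-1) 1)"
    using has_integral_mult_right[of _ 0 "{-1..1}" "2 powr (\<alpha> + \<beta>)"] by simp
  have "(1 - x) powr \<alpha> * (1 + x) powr \<beta> * poly (jacobi_poly n \<alpha> \<beta>) x * poly q x =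
      2 powr (\<alpha> + \<beta>) * (?W ((1/2) *\<^sub>R x + 1/2) * poly r ((1/2) *\<^sub>R x + 1/2))"
    if x: "x \<in> box (-1) 1" for x
  proof -
    have x1: "1 - x > 0" "1 + x > 0" using x by auto
    have "1 - ((1/2) *\<^sub>R x + 1/2) = (1 - x) / 2" "(1/2) *\<^sub>R x + 1/2 = (1 + x) / 2"
      by (auto simp: field_simps)
    moreover have x2: "2 * ((1 + x) / 2) - 1 = x" by argo
    moreover have "poly r ((1 + x) / 2) = poly q x"
      using arg_cong[OF x2, of "poly q"] by (simp add: r_def poly_pcompose algebra_simps)
    moreover have "2 powr (\<alpha> + \<beta>) * (((1 - x) / 2) powr \<alpha> * ((1 + x) / 2) powr \<beta>) =
        (1 - x) powr \<alpha> * (1 + x) powr \<beta>"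
      using x1 by (simp add: powr_divide powr_add)
    ultimately show ?thesis by (simp only: mult.assoc[symmetric])
  qed
  from has_integral_spike_interior[OF J this] show ?thesis by simp
qed

theorem jacobi_poly_iff:
  fixes \<alpha> \<beta> :: real
  assumes ab: "\<alpha> > -1" "\<beta> > -1"
  shows "p = jacobi_poly n \<alpha> \<beta> \<longleftrightarrow>
     degree p \<le> n \<and> poly p 1 = pochhammer (\<alpha> + 1) n / fact n \<and>
     (\<forall>q. degree q < n \<longrightarrow>
        ((\<lambda>x. (1 - x) powr \<alpha> * (1 + x) powr \<beta> * poly p x * poly q x) has_integral 0) {-1..1})"
    (is "_ \<longleftrightarrow> ?R p")
proof
  assume "p = jacobi_poly n \<alpha> \<beta>"
  then show "?R p" using ab jacobi_poly_orthogonal degree_jacobi_poly_le jacobi_poly_at_1 by blast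
next
  assume R: "?R p"
  let ?P = "jacobi_poly n \<alpha> \<beta>"
  define d where "d = p - ?P"
  have "poly d 1 = 0" using R by (simp add: d_def jacobi_poly_at_1)
  then obtain e where e: "d = [:-1, 1:] * e" unfolding poly_eq_0_iff_dvd by (rule dvdE)
  have "e = 0"
  proof (rule ccontr)
    assume e0: "e \<noteq> 0"
    have "degree d \<le> n" unfolding d_def
      using R degree_jacobi_poly_le by (intro degree_diff_le) auto
    moreover have "degree d = Suc (degree e)"
      unfolding e using e0 by (subst degree_mult_eq) auto
    ultimately have de: "degree e < n" by simp
    let ?w = "\<lambda>x::real. (1 - x) powr \<alpha> * (1 + x) powr \<beta>"
    have I: "((\<lambda>x. - (?w x * poly p x * poly e x - ?w x * poly ?P x * poly e x)) has_integral - (0 - 0)) {-1..1}"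
      using R de jacobi_poly_orthogonal[OF ab de] by (intro has_integral_neg has_integral_diff) auto
    have eq: "- (?w x * poly p x * poly e x - ?w x * poly ?P x * poly e x) =
        ?w x * (1 - x) * (poly e x)\<^sup>2" for x
    proof -
      have "poly p x = poly ?P x + (x - 1) * poly e x"
        using arg_cong[OF e, of "\<lambda>p. poly p x"] by (simp add: d_def algebra_simps)
      then show ?thesis by (simp only: power2_eq_square) (simp add: algebra_simps)
    qed
    have J: "((\<lambda>x. ?w x * (1 - x) * (poly e x)\<^sup>2) has_integral 0) {-1..1}"
      using I unfolding eq by simp
    let ?g = "\<lambda>x. ?w x * (1 - x) * (poly e x)\<^sup>2"
    have cont: "continuous_on (cbox (-1/2) (1/2)) ?g"
      by (intro continuous_intros) auto
    then obtain i where i: "(?g has_integral i) (cbox (-1/2) (1/2))"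
      using integrable_continuous by blast
    have i2: "(?g has_integral i) {-1/2..1/2}" using i by simp
    have "i \<le> 0"
      by (rule has_integral_subset_le[OF _ i2 J]) auto
    moreover have "i \<ge> 0"
      by (rule has_integral_nonneg[OF i]) auto
    ultimately have i0: "(?g has_integral 0) (cbox (-1/2) (1/2))" using i by simp
    have z: "poly e x = 0" if "x \<in> cbox (-1/2) (1/2)" for x
    proof -
      have "?g x = 0"
        by (rule has_integral_0_cbox_imp_0[OF cont _ i0 _ that]) auto
      then show ?thesis using that by auto
    qed
    have "{-1/2..1/2} \<subseteq> {x. poly e x = 0}" using z by auto
    then have "finite {-1/2..1/2::real}" using poly_roots_finite[OF e0] finite_subset by blast
    moreover have "infinite {-1/2..1/2::real}" by (rule infinite_Icc) simp
    ultimately show False by blast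
  qed
  then have "d = 0" using e by simp
  then show "p = ?P" by (simp add: d_def)
qed

section \<open>The Cherednik operator\<close>

text \<open>
  The coefficients of the reflection terms are singular at the origin; for smooth \<open>f\<close> the
  function \<open>D f\<close> is understood as extended to \<open>t = 0\<close> by continuity, which gives the value in
  the first branch (see \<open>cherednik_tendsto_0\<close>).
\<close>

definition cherednik :: "real \<Rightarrow> real \<Rightarrow> (real \<Rightarrow> complex) \<Rightarrow> real \<Rightarrow> complex" where
  "cherednik b \<iota> f t =
     (if t = 0 then of_real (1 + \<iota> + 2 * b) * vector_derivative f (at 0) - of_real (b + \<iota>) * f 0
      else vector_derivative f (at t)
           + of_real (2 * \<iota> * (1 / (1 - exp (-4 * t)))) * (f t - f (-t))
           + of_real (2 * b * (1 / (1 - exp (-2 * t)))) * (f t - f (-t))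
           - of_real (b + \<iota>) * f t)"

lemma cherednik_tendsto_0:
  assumes diff: "f differentiable (at 0)" and cont: "isCont (\<lambda>t. vector_derivative f (at t)) 0"
  shows "(cherednik b \<iota> f \<longlongrightarrow> cherednik b \<iota> f 0) (at 0)"
proof -
  define d where "d = vector_derivative f (at 0)"
  have d: "(f has_vector_derivative d) (at 0)"
    unfolding d_def using diff vector_derivative_works by blast
  have d': "((\<lambda>t. f (-t)) has_vector_derivative - d) (at 0)"
  proof -
    have "(uminus has_vector_derivative (-1)) (at (0::real))"
      by (auto intro!: derivative_eq_intros)
    from vector_diff_chain_at[OF this, of f d] d show ?thesis by (simp add: o_def)
  qed
  have "((\<lambda>t. f t - f (-t)) has_vector_derivative (d - (- d))) (at 0)"
    by (intro has_vector_derivative_diff d d')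
  then have q: "((\<lambda>t. (f t - f (-t)) /\<^sub>R t) \<longlongrightarrow> 2 * d) (at 0)"
  proof -
    assume "((\<lambda>t. f t - f (-t)) has_vector_derivative (d - (- d))) (at 0)"
    then have 1: "((\<lambda>t. norm ((f t - f (-t) - t *\<^sub>R (2 * d)) /\<^sub>R \<bar>t\<bar>)) \<longlongrightarrow> 0) (at 0)"
      by (intro tendsto_norm_zero) (simp add: has_vector_derivative_def has_derivative_at_within)
    have 2: "norm ((f t - f (-t) - t *\<^sub>R (2 * d)) /\<^sub>R \<bar>t\<bar>) =
        norm ((f t - f (-t)) /\<^sub>R t - 2 * d)" if "t \<noteq> 0" for t
    proof -
      have "(f t - f (-t)) /\<^sub>R t - 2 * d = (f t - f (-t) - t *\<^sub>R (2 * d)) /\<^sub>R t"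
        using that by (simp add: scaleR_diff_right)
      then show ?thesis by simp
    qed
    have "((\<lambda>t. norm ((f t - f (-t)) /\<^sub>R t - 2 * d)) \<longlongrightarrow> 0) (at 0)"
      by (rule Lim_transform_eventually[OF 1]) (use 2 in \<open>simp add: eventually_at_filter\<close>)
    then show ?thesis by (rule LIM_zero_cancel[OF tendsto_norm_zero_cancel])
  qed
  have ex: "((\<lambda>t. t / (1 - exp (- (c * t)))) \<longlongrightarrow> 1 / c) (at 0)" if c: "c > 0" for c :: real
  proof -
    have "((\<lambda>t. 1 - exp (- (c * t))) has_field_derivative c) (at 0)"
      by (auto intro!: derivative_eq_intros)
    then have "((\<lambda>t. (1 - exp (- (c * t))) / t) \<longlongrightarrow> c) (at 0)"
      by (simp add: has_field_derivative_iff)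
    from tendsto_inverse[OF this] c show ?thesis by (simp add: divide_inverse mult.commute)
  qed
  have main: "((\<lambda>t. of_real (2 * a * (1 / (1 - exp (- c * t)))) * (f t - f (-t))) \<longlongrightarrow>
      of_real (2 * a * (1 / c)) * (2 * d)) (at 0)" if c: "c > 0" for a c :: real
  proof (rule Lim_transform_eventually)
    show "((\<lambda>t. of_real (2 * a * (t / (1 - exp (- (c * t))))) * ((f t - f (-t)) /\<^sub>R t)) \<longlongrightarrow>
      of_real (2 * a * (1 / c)) * (2 * d)) (at 0)"
      by (intro tendsto_mult tendsto_of_real tendsto_const ex q c)
    have "of_real (2 * a * (t / (1 - exp (- (c * t))))) * ((f t - f (-t)) /\<^sub>R t) =
        of_real (2 * a * (1 / (1 - exp (- c * t)))) * (f t - f (-t))" if "t \<noteq> 0" for t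
      using that by (simp add: scaleR_conv_of_real)
    then show "\<forall>\<^sub>F t in at 0. of_real (2 * a * (t / (1 - exp (- (c * t))))) * ((f t - f (-t)) /\<^sub>R t) =
        of_real (2 * a * (1 / (1 - exp (- c * t)))) * (f t - f (-t))"
      unfolding eventually_at_filter by (intro always_eventually allI impI)
  qed
  have f0: "(f \<longlongrightarrow> f 0) (at 0)"
    using diff differentiable_imp_continuous_within isCont_def by blast
  let ?g = "\<lambda>t. vector_derivative f (at t)
           + of_real (2 * \<iota> * (1 / (1 - exp (-4 * t)))) * (f t - f (-t))
           + of_real (2 * b * (1 / (1 - exp (-2 * t)))) * (f t - f (-t))
           - of_real (b + \<iota>) * f t"
  have "(?g \<longlongrightarrow> d + of_real (2 * \<iota> * (1 / 4)) * (2 * d) + of_real (2 * b * (1 / 2)) * (2 * d)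
      - of_real (b + \<iota>) * f 0) (at 0)"
    using cont unfolding isCont_def d_def[symmetric]
    by (intro tendsto_diff tendsto_add main tendsto_mult_left f0) auto
  also have "d + of_real (2 * \<iota> * (1 / 4)) * (2 * d) + of_real (2 * b * (1 / 2)) * (2 * d)
      - of_real (b + \<iota>) * f 0 = cherednik b \<iota> f 0"
    by (simp add: cherednik_def d_def algebra_simps)
  finally show ?thesis
    by (rule Lim_transform_eventually) (simp add: eventually_at_filter cherednik_def)
qed

definition poly_op ::
    "complex poly \<Rightarrow> ((real \<Rightarrow> complex) \<Rightarrow> real \<Rightarrow> complex) \<Rightarrow> (real \<Rightarrow> complex) \<Rightarrow> real \<Rightarrow> complex" where
  "poly_op p D f t = (\<Sum>i\<le>degree p. coeff p i * (D ^^ i) f t)"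

section \<open>Jacobi type functions\<close>

definition rho :: "real \<Rightarrow> real \<Rightarrow> complex" where
  "rho b \<iota> = of_real (b + \<iota>)"

definition sigma0 :: "real \<Rightarrow> real \<Rightarrow> complex \<Rightarrow> complex" where
  "sigma0 b \<iota> \<sigma> = \<sigma> - of_real (\<iota> + b + 1)"

definition delta0 :: "real \<Rightarrow> real \<Rightarrow> complex" where
  "delta0 b \<iota> = of_real ((\<iota> - 1) / 2 + b)"

definition delta1 :: "real \<Rightarrow> real \<Rightarrow> complex" where
  "delta1 b \<iota> = delta0 b \<iota> + 1"

definition weight :: "complex \<Rightarrow> real \<Rightarrow> complex" where
  "weight \<sigma> t = of_real (cosh t) powr (- \<sigma>)"

definition jacobi_fun_even :: "real \<Rightarrow> real \<Rightarrow> complex \<Rightarrow> nat \<Rightarrow> real \<Rightarrow> complex" where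
  "jacobi_fun_even b \<iota> \<sigma> n t =
     weight \<sigma> t * poly (jacobi_poly n (sigma0 b \<iota> \<sigma>) (delta0 b \<iota>)) (of_real (2 * (tanh t)\<^sup>2 - 1))"

definition jacobi_fun_odd :: "real \<Rightarrow> real \<Rightarrow> complex \<Rightarrow> nat \<Rightarrow> real \<Rightarrow> complex" where
  "jacobi_fun_odd b \<iota> \<sigma> n t =
     weight \<sigma> t * poly (jacobi_poly n (sigma0 b \<iota> \<sigma>) (delta1 b \<iota>)) (of_real (2 * (tanh t)\<^sup>2 - 1))
       * of_real (tanh t)"

definition calQ_even :: "real \<Rightarrow> real \<Rightarrow> complex \<Rightarrow> nat \<Rightarrow> complex \<Rightarrow> complex" where
  "calQ_even b \<iota> \<sigma> n x =
     pochhammer (sigma0 b \<iota> \<sigma> + 1) n / fact n *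
     hypergeom
       [- of_nat n, of_nat n + sigma0 b \<iota> \<sigma> + delta0 b \<iota> + 1,
        (\<sigma> - rho b \<iota> + x) / 2, (\<sigma> - rho b \<iota> - x) / 2]
       [sigma0 b \<iota> \<sigma> + 1, (\<sigma> + 1 - of_real \<iota>) / 2, \<sigma> / 2] 1"

definition calQ_odd :: "real \<Rightarrow> real \<Rightarrow> complex \<Rightarrow> nat \<Rightarrow> complex \<Rightarrow> complex" where
  "calQ_odd b \<iota> \<sigma> n x =
     pochhammer (sigma0 b \<iota> \<sigma> + 1) n / (fact n * (- \<sigma>)) * (rho b \<iota> + x) *
     hypergeom
       [- of_nat n, of_nat n + sigma0 b \<iota> \<sigma> + delta1 b \<iota> + 1,
        (\<sigma> - rho b \<iota> + x) / 2, (\<sigma> - rho b \<iota> - x) / 2]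
       [sigma0 b \<iota> \<sigma> + 1, (\<sigma> + 1 - of_real \<iota>) / 2, \<sigma> / 2 + 1] 1"

end

theory Submission
  imports Defs
begin

text \<open>
  On even functions \<open>D\<^sup>2 - \<rho>\<^sup>2\<close> is the Jacobi operator
  \<open>f'' + (2\<iota> coth 2t + 2b coth t) f'\<close>, and a direct computation gives
  \<open>((\<sigma> - \<rho>)\<^sup>2 - D\<^sup>2) w\<^sub>\<sigma> = \<sigma> (\<sigma> + 1 - \<iota>) w\<^bsub>\<sigma>+2\<^esub>\<close>.  Iterating, the polynomial
  \<open>((\<sigma> - \<rho> + x)/2)\<^sub>m ((\<sigma> - \<rho> - x)/2)\<^sub>m\<close> evaluated at \<open>D\<close> maps \<open>w\<^sub>\<sigma>\<close> to
  \<open>(\<sigma>/2)\<^sub>m ((\<sigma> + 1 - \<iota>)/2)\<^sub>m w\<^bsub>\<sigma>+2m\<^esub>\<close>, which reduces the \<open>\<^sub>4F\<^sub>3\<close> to the \<open>\<^sub>2F\<^sub>1\<close> in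
  \<open>1 - tanh\<^sup>2 t\<close> that represents the Jacobi polynomial.  The odd case follows by applying \<open>\<rho> + D\<close>,
  since \<open>(\<rho> + D) w\<^sub>\<tau> = - \<tau> w\<^sub>\<tau> tanh t\<close>.
\<close>

section \<open>Terminating hypergeometric sums and the expansion of Jacobi polynomials at 1\<close>

lemma hypergeom_terminating:
  "hypergeom (- of_nat n # as) bs 1 =
     (\<Sum>m\<le>n. pochhammer (- of_nat n) m * (\<Prod>a\<leftarrow>as. pochhammer a m) /
        (\<Prod>b\<leftarrow>bs. pochhammer b m) / fact m)"
proof -
  have "pochhammer (- of_nat n :: complex) m = 0" if "m \<notin> {..n}" for m
    using that by (simp add: pochhammer_of_nat_eq_0_iff)
  then show ?thesis
    unfolding hypergeom_def by (subst suminf_finite[of "{..n}"]) auto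
qed

text \<open>Taylor expansion at x = 1: with y = (x - 1)/2 one has (x + 1)/2 = y + 1; expanding its
  powers and exchanging the sums leaves a Vandermonde convolution as the coefficient of y^m.\<close>

lemma jacobi_poly_binomial_expansion:
  fixes \<alpha> \<beta> x :: "'a :: field_char_0"
  shows "poly (jacobi_poly n \<alpha> \<beta>) x =
     (\<Sum>m\<le>n. ((of_nat n + \<alpha>) gchoose (n - m)) * ((of_nat n + \<alpha> + \<beta> + of_nat m) gchoose m)
        * ((x - 1) / 2) ^ m)"
proof -
  define y where "y = (x - 1) / 2"
  have y1: "(x + 1) / 2 = y + 1" by (simp add: y_def field_simps)
  let ?A = "\<lambda>k. (of_nat n + \<alpha>) gchoose k"
  let ?B = "\<lambda>k. (of_nat n + \<beta>) gchoose k"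
  have "poly (jacobi_poly n \<alpha> \<beta>) x = (\<Sum>s\<le>n. ?A (n - s) * ?B s * (y ^ s * (y + 1) ^ (n - s)))"
    unfolding poly_jacobi_poly y1 y_def[symmetric] by simp
  also have "\<dots> = (\<Sum>s\<le>n. \<Sum>m\<in>{s..n}. ?A (n - s) * ?B s * of_nat ((n - s) choose (m - s)) * y ^ m)"
  proof (intro sum.cong refl)
    fix s assume s: "s \<in> {..n}"
    have "(y + 1) ^ (n - s) = (\<Sum>j\<le>n - s. of_nat ((n - s) choose j) * y ^ j)"
      by (simp add: binomial_ring)
    then have "?A (n - s) * ?B s * (y ^ s * (y + 1) ^ (n - s)) =
        (\<Sum>j\<le>n - s. ?A (n - s) * ?B s * of_nat ((n - s) choose j) * y ^ (j + s))"
      by (simp add: sum_distrib_left power_add mult_ac)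
    also have "\<dots> = (\<Sum>m\<in>{s..n}. ?A (n - s) * ?B s * of_nat ((n - s) choose (m - s)) * y ^ m)"
      using s by (intro sum.reindex_bij_witness[of _ "\<lambda>m. m - s" "\<lambda>j. j + s"]) auto
    finally show "?A (n - s) * ?B s * (y ^ s * (y + 1) ^ (n - s)) = \<dots>" .
  qed
  also have "\<dots> = (\<Sum>m\<le>n. \<Sum>s\<le>m. ?A (n - s) * ?B s * of_nat ((n - s) choose (m - s)) * y ^ m)"
    unfolding sum.Sigma[OF finite_atMost ballI[OF finite_atMost]]
      sum.Sigma[OF finite_atMost ballI[OF finite_atLeastAtMost]]
    by (intro sum.reindex_bij_witness[of _ "\<lambda>(m, s). (s, m)" "\<lambda>(s, m). (m, s)"]) auto
  also have "\<dots> = (\<Sum>m\<le>n. ?A (n - m) * ((of_nat n + \<alpha> + \<beta> + of_nat m) gchoose m) * y ^ m)"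
  proof (intro sum.cong refl)
    fix m assume m: "m \<in> {..n}"
    have "?A (n - s) * ?B s * of_nat ((n - s) choose (m - s)) * y ^ m =
        ?A (n - m) * y ^ m * (?B s * ((of_nat m + \<alpha>) gchoose (m - s)))" if s: "s \<le> m" for s
    proof -
      \<comment> \<open>Trinomial revision splits off \<open>?A (n - m)\<close>, which is free of s;
        what still depends on s is a Vandermonde sum with upper entries n + \<beta> and m +
        \<alpha>.\<close>
      have "?A (n - s) * (of_nat (n - s) gchoose (n - m)) =
          ?A (n - m) * ((of_nat n + \<alpha> - of_nat (n - m)) gchoose ((n - s) - (n - m)))"
        by (rule gbinomial_trinomial_revision) (use s in auto)
      moreover have "(n - s) choose (m - s) = (n - s) choose (n - m)"
        using binomial_symmetric[of "m - s" "n - s"] s m by auto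
      moreover have "of_nat n + \<alpha> - of_nat (n - m) = of_nat m + \<alpha>"
        using m by (simp add: of_nat_diff)
      moreover have "(n - s) - (n - m) = m - s" using m s by auto
      ultimately show ?thesis by (simp add: binomial_gbinomial)
    qed
    then have "(\<Sum>s\<le>m. ?A (n - s) * ?B s * of_nat ((n - s) choose (m - s)) * y ^ m) =
        ?A (n - m) * y ^ m * (\<Sum>s\<le>m. ?B s * ((of_nat m + \<alpha>) gchoose (m - s)))"
      unfolding sum_distrib_left by (intro sum.cong refl) (simp only: atMost_iff)
    also have "(\<Sum>s\<le>m. ?B s * ((of_nat m + \<alpha>) gchoose (m - s))) =
        ((of_nat n + \<beta> + (of_nat m + \<alpha>)) gchoose m)"
      by (simp only: gbinomial_Vandermonde flip: atLeast0AtMost)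
    finally show "(\<Sum>s\<le>m. ?A (n - s) * ?B s * of_nat ((n - s) choose (m - s)) * y ^ m) =
        ?A (n - m) * ((of_nat n + \<alpha> + \<beta> + of_nat m) gchoose m) * y ^ m"
      by (simp add: add_ac mult_ac)
  qed
  finally show ?thesis by (simp add: y_def)
qed

text \<open>Nonvanishing of (\<alpha> + 1)_n passes to (\<alpha> + 1)_m for m <= n, so the binomials
  become Pochhammer quotients term by term. The sign in (-n)_m = (-1)^m n!/(n - m)! turns (x - 1)/2
  into (1 - x)/2.\<close>

lemma jacobi_poly_hypergeometric:
  fixes \<alpha> \<beta> x :: "'a :: field_char_0"
  assumes "pochhammer (\<alpha> + 1) n \<noteq> 0"
  shows "poly (jacobi_poly n \<alpha> \<beta>) x = (\<Sum>m\<le>n. pochhammer (\<alpha> + 1) n / fact n *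
     (pochhammer (- of_nat n) m * pochhammer (of_nat n + \<alpha> + \<beta> + 1) m /
       (pochhammer (\<alpha> + 1) m * fact m)) * ((1 - x) / 2) ^ m)"
  unfolding jacobi_poly_binomial_expansion
proof (intro sum.cong refl)
  fix m assume m: "m \<in> {..n}"
  have split: "pochhammer (\<alpha> + 1) n = pochhammer (\<alpha> + 1) m * pochhammer (\<alpha> + 1 + of_nat m) (n - m)"
    using pochhammer_product[of m n "\<alpha> + 1"] m by simp
  then have nz: "pochhammer (\<alpha> + 1) m \<noteq> 0" using assms by auto
  have 1: "((of_nat n + \<alpha>) gchoose (n - m)) =
      pochhammer (\<alpha> + 1) n / (pochhammer (\<alpha> + 1) m * fact (n - m))"
    unfolding split using m nz by (simp add: gbinomial_pochhammer' of_nat_diff add_ac)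
  have 2: "((of_nat n + \<alpha> + \<beta> + of_nat m) gchoose m) = pochhammer (of_nat n + \<alpha> + \<beta> + 1) m / fact m"
    by (simp add: gbinomial_pochhammer')
  have 3: "pochhammer (- of_nat n :: 'a) m = (-1) ^ m * (fact n / fact (n - m))"
  proof -
    have "(of_nat n gchoose m :: 'a) = fact n / (fact m * fact (n - m))"
      using m by (simp add: binomial_gbinomial[symmetric] binomial_fact)
    then have "(-1) ^ m * pochhammer (- of_nat n :: 'a) m = fact n / fact (n - m)"
      by (simp add: gbinomial_pochhammer field_simps)
    then show ?thesis
      by (metis (no_types, lifting) left_minus_one_mult_self)
  qed
  have "((x - 1) / 2) ^ m = (-1) ^ m * ((1 - x) / 2) ^ m"
    by (simp add: power_mult_distrib[symmetric] field_simps)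
  then show "((of_nat n + \<alpha>) gchoose (n - m)) * ((of_nat n + \<alpha> + \<beta> + of_nat m) gchoose m) *
      ((x - 1) / 2) ^ m = pochhammer (\<alpha> + 1) n / fact n *
     (pochhammer (- of_nat n) m * pochhammer (of_nat n + \<alpha> + \<beta> + 1) m /
       (pochhammer (\<alpha> + 1) m * fact m)) * ((1 - x) / 2) ^ m"
    unfolding 1 2 3 using nz by (simp add: field_simps)
qed

section \<open>Polynomials in an operator\<close>

lemma poly_op_pCons: "poly_op (pCons a p) D f = (\<lambda>t. a * f t + poly_op p D (D f) t)"
proof
  fix t
  \<comment> \<open>Padding with zero coefficients covers p = 0, where \<open>pCons a p\<close> has
    degree 0 and not \<open>Suc (degree p)\<close>.\<close>
  have bound: "poly_op q D g t = (\<Sum>i\<le>N. coeff q i * (D ^^ i) g t)" if "degree q \<le> N" for q g N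
    unfolding poly_op_def using that
    by (intro sum.mono_neutral_left) (auto simp: coeff_eq_0)
  have "poly_op (pCons a p) D f t = (\<Sum>i\<le>Suc (degree p). coeff (pCons a p) i * (D ^^ i) f t)"
    by (rule bound[OF degree_pCons_le])
  also have "\<dots> = a * f t + (\<Sum>i\<le>degree p. coeff p i * (D ^^ i) (D f) t)"
    by (subst sum.atMost_Suc_shift) (simp add: funpow_swap1)
  finally show "poly_op (pCons a p) D f t = a * f t + poly_op p D (D f) t"
    by (simp add: poly_op_def)
qed

lemma poly_op_0: "poly_op 0 D f = (\<lambda>t. 0)"
  by (simp add: poly_op_def fun_eq_iff)

lemma poly_op_add: "poly_op (p + q) D f = (\<lambda>t. poly_op p D f t + poly_op q D f t)"
  by (induction p q arbitrary: f rule: poly_induct2)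
     (simp_all add: poly_op_0 poly_op_pCons algebra_simps)

lemma poly_op_smult: "poly_op (smult c p) D f = (\<lambda>t. c * poly_op p D f t)"
  by (induction p arbitrary: f) (simp_all add: poly_op_0 poly_op_pCons algebra_simps)

lemma poly_op_sum: "poly_op (\<Sum>i\<in>A. p i) D f = (\<lambda>t. \<Sum>i\<in>A. poly_op (p i) D f t)"
  by (induction A rule: infinite_finite_induct) (simp_all add: poly_op_0 poly_op_add)

text \<open>Linearity is asked only on a class V, because \<open>vector_derivative\<close> is an
  arbitrary choice where no derivative exists. Invariance of V under D keeps all iterates inside
  it.\<close>

locale linear_operator_on =
  fixes V :: "(real \<Rightarrow> complex) \<Rightarrow> bool" and D
  assumes V_add: "V f \<Longrightarrow> V g \<Longrightarrow> V (\<lambda>t. f t + g t)"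
    and V_scale: "V f \<Longrightarrow> V (\<lambda>t. c * f t)"
    and V_D: "V f \<Longrightarrow> V (D f)"
    and D_add: "V f \<Longrightarrow> V g \<Longrightarrow> D (\<lambda>t. f t + g t) = (\<lambda>t. D f t + D g t)"
    and D_scale: "V f \<Longrightarrow> D (\<lambda>t. c * f t) = (\<lambda>t. c * D f t)"
begin

lemma V_poly_op: "V f \<Longrightarrow> V (poly_op p D f)"
proof (induction p arbitrary: f)
  case 0
  then show ?case using V_scale[of f 0] by (simp add: poly_op_0)
next
  case (pCons a p)
  then show ?case unfolding poly_op_pCons by (intro V_add V_scale pCons.IH V_D)
qed

lemma poly_op_D: "V f \<Longrightarrow> poly_op p D (D f) = D (poly_op p D f)"
proof (induction p arbitrary: f)
  case 0
  then show ?case using D_scale[of f 0] by (simp add: poly_op_0)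
next
  case (pCons a p)
  then show ?case
    by (simp add: poly_op_pCons D_add D_scale V_scale V_poly_op V_D)
qed

text \<open>Here linearity of D enters: the induction step moves D past \<open>poly_op q D\<close>
  by \<open>poly_op_D\<close>.\<close>

lemma poly_op_mult: "V f \<Longrightarrow> poly_op (p * q) D f = poly_op p D (poly_op q D f)"
proof (induction p arbitrary: f)
  case 0
  then show ?case by (simp add: poly_op_0)
next
  case (pCons a p)
  then show ?case
    by (simp add: poly_op_pCons poly_op_add poly_op_smult poly_op_D V_D V_poly_op)
qed

end

section \<open>The Cherednik operator on powers of 1/cosh\<close>

lemma cherednik_add:
  assumes "\<And>t. f differentiable (at t)" "\<And>t. g differentiable (at t)"
  shows "cherednik b \<iota> (\<lambda>t. f t + g t) = (\<lambda>t. cherednik b \<iota> f t + cherednik b \<iota> g t)"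
proof -
  have "vector_derivative (\<lambda>t. f t + g t) (at t) =
      vector_derivative f (at t) + vector_derivative g (at t)" for t
    using assms by (intro vector_derivative_at has_vector_derivative_add)
      (simp_all flip: vector_derivative_works)
  then show ?thesis
    by (auto simp: cherednik_def fun_eq_iff algebra_simps add_divide_distrib diff_divide_distrib)
qed

lemma cherednik_scale:
  assumes "\<And>t. f differentiable (at t)"
  shows "cherednik b \<iota> (\<lambda>t. c * f t) = (\<lambda>t. c * cherednik b \<iota> f t)"
proof -
  have "vector_derivative (\<lambda>t. c * f t) (at t) = c * vector_derivative f (at t)" for t
    using assms by (intro vector_derivative_at has_vector_derivative_mult_right)
      (simp flip: vector_derivative_works)
  then show ?thesis
    by (auto simp: cherednik_def fun_eq_iff algebra_simps add_divide_distrib diff_divide_distrib)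
qed

lemma weight_minus: "weight \<sigma> (- t) = weight \<sigma> t"
  by (simp add: weight_def)

text \<open>Since 1 - tanh^2 = 1/cosh^2, powers of 1 - tanh^2 t are absorbed as shifts of the
  parameter.\<close>

lemma weight_shift: "weight (\<sigma> + 2 * of_nat m) t = weight \<sigma> t * of_real ((1 - (tanh t)\<^sup>2) ^ m)"
proof -
  have c: "cosh t > 0" "1 + (sinh t)\<^sup>2 \<noteq> 0"
    using zero_le_power2[of "sinh t"] by (simp, linarith)
  have "1 - (tanh t)\<^sup>2 = inverse ((cosh t)\<^sup>2)"
    using c hyperbolic_pythagoras[of t] by (simp add: tanh_def power_divide cosh_square_eq field_simps)
  then have "of_real ((1 - (tanh t)\<^sup>2) ^ m) = (of_real (cosh t) :: complex) powr (- of_nat (2 * m))"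
    using c by (simp add: powr_minus powr_nat' power_mult power_inverse del: of_nat_mult)
  then show ?thesis
    by (simp add: weight_def algebra_simps flip: powr_add)
qed

lemma weight_shift_1: "weight (\<sigma> + 2) t = weight \<sigma> t * (1 - (of_real (tanh t))\<^sup>2)"
  using weight_shift[of \<sigma> 1 t] by simp

lemma has_vector_derivative_weight:
  "(weight \<sigma> has_vector_derivative (- \<sigma> * of_real (tanh t) * weight \<sigma> t)) (at t)"
proof -
  \<comment> \<open>cosh t lies off the branch cut of the principal power, so the chain rule
    applies.\<close>
  have c: "complex_of_real (cosh t) \<notin> \<real>\<^sub>\<le>\<^sub>0" "cosh t \<noteq> 0"
    using cosh_real_pos[of t] by (simp_all add: complex_nonpos_Reals_iff not_le del: cosh_real_pos)
  have "((\<lambda>z. z powr (- \<sigma>)) has_field_derivative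
      (- \<sigma> * of_real (cosh t) powr (- \<sigma> - 1))) (at (of_real (cosh t)))"
    using c(1) by (rule has_field_derivative_powr)
  moreover have "((\<lambda>t. of_real (cosh t) :: complex) has_vector_derivative of_real (sinh t)) (at t)"
    by (rule has_vector_derivative_of_real) (auto intro!: derivative_eq_intros simp flip: has_real_derivative_iff_has_vector_derivative)
  ultimately have "(weight \<sigma> has_vector_derivative
      of_real (sinh t) * (- \<sigma> * of_real (cosh t) powr (- \<sigma> - 1))) (at t)"
    unfolding weight_def using field_vector_diff_chain_at by (fastforce simp: o_def)
  also have "of_real (sinh t) * (- \<sigma> * of_real (cosh t) powr (- \<sigma> - 1)) =
      - \<sigma> * of_real (tanh t) * weight \<sigma> t"
    using c by (simp add: weight_def tanh_def powr_diff)
  finally show ?thesis .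
qed

lemma has_vector_derivative_tanh_weight:
  "((\<lambda>t. of_real (tanh t) * weight \<sigma> t) has_vector_derivative
     (1 - (1 + \<sigma>) * (of_real (tanh t))\<^sup>2) * weight \<sigma> t) (at t)"
proof -
  have "cosh t \<noteq> 0" using cosh_real_pos[of t] by simp
  then have "(tanh has_real_derivative (1 - (tanh t)\<^sup>2)) (at t)"
    by (auto intro!: derivative_eq_intros)
  then have "((\<lambda>t. of_real (tanh t) :: complex) has_vector_derivative of_real (1 - (tanh t)\<^sup>2)) (at t)"
    by (intro has_vector_derivative_of_real)
       (simp flip: has_real_derivative_iff_has_vector_derivative)
  from has_vector_derivative_mult[OF this has_vector_derivative_weight[of \<sigma> t]]
  show ?thesis by (simp add: algebra_simps power2_eq_square)
qed

text \<open>The weight is even, so both reflection terms vanish.\<close>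

lemma cherednik_weight:
  "cherednik b \<iota> (weight \<sigma>) =
     (\<lambda>t. (- \<sigma>) * (of_real (tanh t) * weight \<sigma> t) + (- rho b \<iota>) * weight \<sigma> t)"
  by (auto simp: fun_eq_iff cherednik_def rho_def weight_minus
        vector_derivative_at[OF has_vector_derivative_weight] algebra_simps)

text \<open>On an odd function 1 - s is multiplication by 2, and tanh t cancels the poles of the
  reflection coefficients. The result is quadratic in tanh t, and the square is traded for
  \<open>weight (\<sigma> + 2)\<close>.\<close>

lemma cherednik_tanh_weight:
  "cherednik b \<iota> (\<lambda>t. of_real (tanh t) * weight \<sigma> t) =
     (\<lambda>t. rho b \<iota> * (of_real (tanh t) * weight \<sigma> t) +
       ((2 * rho b \<iota> - \<sigma>) * weight \<sigma> t + (1 + \<sigma> - of_real \<iota>) * weight (\<sigma> + 2) t))"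
proof
  fix t :: real
  let ?T = "tanh t" and ?C = "complex_of_real"
  have main: "?C (2 * \<iota> * (1 / (1 - exp (-4 * t)))) * (2 * ?C ?T) = ?C (\<iota> * (1 + ?T)\<^sup>2)"
    "?C (2 * b * (1 / (1 - exp (-2 * t)))) * (2 * ?C ?T) = ?C (2 * b * (1 + ?T))" if "t \<noteq> 0"
  proof -
    \<comment> \<open>In terms of E, tanh t = (1 - E)/(1 + E) and 1 - exp(-4t) = (1 - E)(1 + E). The
      factor 1 - E drops out, and 2/(1 + E) is 1 + tanh t.\<close>
    define E where "E = exp (-2 * t)"
    have E: "E > 0" "E \<noteq> 1" "exp (-4 * t) = E * E"
      using that by (auto simp: E_def simp flip: exp_add)
    have nz: "1 - E \<noteq> 0" "1 + E \<noteq> 0" "1 - E * E = (1 - E) * (1 + E)"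
      using E by (auto simp: algebra_simps)
    have T: "?T = (1 - E) / (1 + E)" by (simp add: tanh_real_altdef E_def)
    have T1: "1 + ?T = 2 / (1 + E)" unfolding T using nz by (simp add: field_simps)
    have cancel: "2 * \<iota> * (1 / (p * q)) * (2 * (p / q)) = \<iota> * (2 / q)\<^sup>2"
      "2 * b * (1 / p) * (2 * (p / q)) = 2 * b * (2 / q)"
      if "p \<noteq> 0" "q \<noteq> 0" for p q
      using that by (simp_all add: power2_eq_square)
    have e1: "2 * \<iota> * (1 / (1 - exp (-4 * t))) * (2 * ?T) = \<iota> * (1 + ?T)\<^sup>2"
      unfolding T1 unfolding T E(3) nz(3) by (rule cancel(1)[OF nz(1,2)])
    have e2: "2 * b * (1 / (1 - exp (-2 * t))) * (2 * ?T) = 2 * b * (1 + ?T)"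
      unfolding T1 unfolding T E_def[symmetric] by (rule cancel(2)[OF nz(1,2)])
    show "?C (2 * \<iota> * (1 / (1 - exp (-4 * t)))) * (2 * ?C ?T) = ?C (\<iota> * (1 + ?T)\<^sup>2)"
      "?C (2 * b * (1 / (1 - exp (-2 * t)))) * (2 * ?C ?T) = ?C (2 * b * (1 + ?T))"
      using arg_cong[OF e1, of ?C] arg_cong[OF e2, of ?C]
      by (simp_all only: of_real_mult of_real_numeral)
  qed
  show "cherednik b \<iota> (\<lambda>t. ?C (tanh t) * weight \<sigma> t) t =
     rho b \<iota> * (?C ?T * weight \<sigma> t) +
       ((2 * rho b \<iota> - \<sigma>) * weight \<sigma> t + (1 + \<sigma> - ?C \<iota>) * weight (\<sigma> + 2) t)"
  proof (cases "t = 0")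
    \<comment> \<open>At the origin the continuous extension counts: tanh 0 = 0 leaves only the
      derivative, with factor 1 + \<iota> + 2b.\<close>
    case True
    then show ?thesis
      unfolding cherednik_def vector_derivative_at[OF has_vector_derivative_tanh_weight]
      by (simp add: rho_def weight_shift_1 algebra_simps)
  next
    case False
    have odd: "?C ?T * weight \<sigma> t - ?C (tanh (- t)) * weight \<sigma> (- t) = (2 * ?C ?T) * weight \<sigma> t"
      by (simp add: weight_minus)
    have "cherednik b \<iota> (\<lambda>t. ?C (tanh t) * weight \<sigma> t) t =
        (1 - (1 + \<sigma>) * (?C ?T)\<^sup>2) * weight \<sigma> t + ?C (\<iota> * (1 + ?T)\<^sup>2) * weight \<sigma> t
        + ?C (2 * b * (1 + ?T)) * weight \<sigma> t - rho b \<iota> * (?C ?T * weight \<sigma> t)"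
      unfolding cherednik_def vector_derivative_at[OF has_vector_derivative_tanh_weight] odd
        mult.assoc[symmetric] main[OF False, symmetric] rho_def
      using False by simp
    then show ?thesis
      by (simp add: rho_def weight_shift_1 algebra_simps power2_eq_square)
  qed
qed

text \<open>A space of differentiable functions invariant under D. It takes all parameters at once
  because D brings in \<sigma> + 2.\<close>

inductive weight_span :: "(real \<Rightarrow> complex) \<Rightarrow> bool" where
  weight: "weight_span (weight \<sigma>)"
| tanh_weight: "weight_span (\<lambda>t. of_real (tanh t) * weight \<sigma> t)"
| add: "weight_span f \<Longrightarrow> weight_span g \<Longrightarrow> weight_span (\<lambda>t. f t + g t)"
| scale: "weight_span f \<Longrightarrow> weight_span (\<lambda>t. c * f t)"

lemma weight_span_differentiable: "weight_span f \<Longrightarrow> f differentiable (at t)"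
proof (induction rule: weight_span.induct)
  case (weight \<sigma>)
  then show ?case using has_vector_derivative_weight differentiableI_vector by blast
next
  case (tanh_weight \<sigma>)
  then show ?case using has_vector_derivative_tanh_weight differentiableI_vector by blast
qed auto

lemma weight_span_cherednik: "weight_span f \<Longrightarrow> weight_span (cherednik b \<iota> f)"
proof (induction rule: weight_span.induct)
  case (weight \<sigma>)
  show ?case unfolding cherednik_weight by (intro weight_span.intros)
next
  case (tanh_weight \<sigma>)
  show ?case unfolding cherednik_tanh_weight by (intro weight_span.intros)
qed (simp_all add: cherednik_add cherednik_scale weight_span_differentiable weight_span.intros)

interpretation cherednik: linear_operator_on weight_span "cherednik b \<iota>" for b \<iota>
  by unfold_locales
     (simp_all add: weight_span.intros weight_span_cherednik cherednik_add cherednik_scale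
       weight_span_differentiable)

section \<open>The product of the two Pochhammer symbols in x, evaluated at D\<close>

text \<open>Each factor is ((a + 2k)/2)^2 - x^2/4 = ((a + x)/2 + k)((a - x)/2 + k).\<close>

definition shift_poly :: "complex \<Rightarrow> nat \<Rightarrow> complex poly" where
  "shift_poly a m = (\<Prod>k<m. [:((a + 2 * of_nat k) / 2)\<^sup>2, 0, -1/4:])"

lemma poly_shift_poly:
  "poly (shift_poly a m) x = pochhammer ((a + x) / 2) m * pochhammer ((a - x) / 2) m"
  unfolding shift_poly_def pochhammer_prod poly_prod prod.distrib[symmetric] atLeast0LessThan
  by (intro prod.cong refl) (simp add: field_simps power2_eq_square)

lemma poly_op_shift_poly_weight:
  "poly_op (shift_poly (\<sigma> - rho b \<iota>) m) (cherednik b \<iota>) (weight \<sigma>) =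
     (\<lambda>t. pochhammer (\<sigma> / 2) m * pochhammer ((\<sigma> + 1 - of_real \<iota>) / 2) m *
       weight (\<sigma> + 2 * of_nat m) t)"
proof (induction m)
  case 0
  show ?case by (simp add: shift_poly_def one_pCons poly_op_pCons poly_op_0)
next
  case (Suc m)
  let ?D = "cherednik b \<iota>" and ?\<tau> = "\<sigma> + 2 * of_nat m"
  let ?q = "[:((\<sigma> - rho b \<iota> + 2 * of_nat m) / 2)\<^sup>2, 0, -1/4:]"
  \<comment> \<open>The square of D reproduces the weight with factor (\<tau> - \<rho>)^2 and adds a
    multiple of the next weight; the constant term of \<open>?q\<close> is chosen to cancel the
    former.\<close>
  have D2: "?D (?D (weight ?\<tau>)) = (\<lambda>t. (?\<tau> - rho b \<iota>)\<^sup>2 * weight ?\<tau> t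
      - ?\<tau> * (?\<tau> + 1 - of_real \<iota>) * weight (?\<tau> + 2) t)"
    unfolding cherednik_weight
    by (simp only: cherednik.D_add cherednik.D_scale weight_span.intros
          cherednik_weight cherednik_tanh_weight)
       (simp add: fun_eq_iff algebra_simps power2_eq_square)
  have "shift_poly (\<sigma> - rho b \<iota>) (Suc m) = ?q * shift_poly (\<sigma> - rho b \<iota>) m"
    by (simp add: shift_poly_def mult.commute)
  then have "poly_op (shift_poly (\<sigma> - rho b \<iota>) (Suc m)) ?D (weight \<sigma>) =
      poly_op ?q ?D (\<lambda>t. pochhammer (\<sigma> / 2) m * pochhammer ((\<sigma> + 1 - of_real \<iota>) / 2) m * weight ?\<tau> t)"
    by (simp only: cherednik.poly_op_mult[OF weight_span.weight] Suc.IH)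
  also have "\<dots> = (\<lambda>t. pochhammer (\<sigma> / 2) m * pochhammer ((\<sigma> + 1 - of_real \<iota>) / 2) m *
      (((?\<tau> - rho b \<iota>) / 2)\<^sup>2 * weight ?\<tau> t - ?D (?D (weight ?\<tau>)) t / 4))"
    by (simp only: poly_op_pCons poly_op_0 cherednik.D_scale cherednik.V_D weight_span.intros)
       (simp add: fun_eq_iff algebra_simps)
  also have "\<dots> = (\<lambda>t. pochhammer (\<sigma> / 2) (Suc m) * pochhammer ((\<sigma> + 1 - of_real \<iota>) / 2) (Suc m) *
       weight (\<sigma> + 2 * of_nat (Suc m)) t)"
  proof
    fix t
    \<comment> \<open>The surviving coefficient \<tau>(\<tau> + 1 - \<iota>)/4 is the product of the
      next factors of the two Pochhammer symbols.\<close>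
    have "((?\<tau> - rho b \<iota>) / 2)\<^sup>2 * weight ?\<tau> t - ?D (?D (weight ?\<tau>)) t / 4 =
        (\<sigma> / 2 + of_nat m) * ((\<sigma> + 1 - of_real \<iota>) / 2 + of_nat m) * weight (?\<tau> + 2) t"
      unfolding D2 by (simp add: field_simps power2_eq_square)
    moreover have "?\<tau> + 2 = \<sigma> + 2 * of_nat (Suc m)" by simp
    ultimately show "pochhammer (\<sigma> / 2) m * pochhammer ((\<sigma> + 1 - of_real \<iota>) / 2) m *
      (((?\<tau> - rho b \<iota>) / 2)\<^sup>2 * weight ?\<tau> t - ?D (?D (weight ?\<tau>)) t / 4) =
      pochhammer (\<sigma> / 2) (Suc m) * pochhammer ((\<sigma> + 1 - of_real \<iota>) / 2) (Suc m) *
       weight (\<sigma> + 2 * of_nat (Suc m)) t"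
      by (simp only: pochhammer_Suc mult_ac)
  qed
  finally show ?case .
qed

text \<open>Adding \<rho> to D cancels the even part of \<open>cherednik_weight\<close>, so the
  shifted weight becomes a multiple of its product with tanh.\<close>

lemma poly_op_rho_shift_poly_weight:
  "poly_op ([:rho b \<iota>, 1:] * shift_poly (\<sigma> - rho b \<iota>) m) (cherednik b \<iota>) (weight \<sigma>) =
     (\<lambda>t. - (\<sigma> + 2 * of_nat m) * pochhammer (\<sigma> / 2) m * pochhammer ((\<sigma> + 1 - of_real \<iota>) / 2) m *
       (of_real (tanh t) * weight (\<sigma> + 2 * of_nat m) t))"
  unfolding cherednik.poly_op_mult[OF weight_span.weight] poly_op_shift_poly_weight
  by (simp only: poly_op_pCons poly_op_0 cherednik.D_scale weight_span.intros cherednik_weight)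
     (simp add: fun_eq_iff algebra_simps)

section \<open>Assembly of the Rodrigues formulas\<close>

lemma pochhammer_nonzero_le:
  fixes a :: "'a :: field_char_0"
  assumes "pochhammer a n \<noteq> 0" "m \<le> n"
  shows "pochhammer a m \<noteq> 0"
  using pochhammer_product[OF assms(2), of a] assms(1) by auto

text \<open>The nonvanishing conditions keep the denominators of the terms m <= n away from 0. As a
  polynomial over the complex numbers is determined by its values, p is unique and its value at D is
  unambiguous.\<close>

theorem theorem3p5:
  fixes b \<iota> :: real and \<sigma> :: complex and n :: nat
  assumes "b > 0" and "\<iota> > 0"
    and "pochhammer (sigma0 b \<iota> \<sigma> + 1) n \<noteq> 0"
    and "pochhammer ((\<sigma> + 1 - of_real \<iota>) / 2) n \<noteq> 0"
  shows "(pochhammer (\<sigma> / 2) n \<noteq> 0 \<longrightarrow>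
           (\<exists>p. poly p = calQ_even b \<iota> \<sigma> n \<and>
                jacobi_fun_even b \<iota> \<sigma> n = poly_op p (cherednik b \<iota>) (weight \<sigma>))) \<and>
         (\<sigma> \<noteq> 0 \<and> pochhammer (\<sigma> / 2 + 1) n \<noteq> 0 \<longrightarrow>
           (\<exists>p. poly p = calQ_odd b \<iota> \<sigma> n \<and>
                jacobi_fun_odd b \<iota> \<sigma> n = poly_op p (cherednik b \<iota>) (weight \<sigma>)))"
proof (intro conjI impI)
  let ?\<alpha> = "sigma0 b \<iota> \<sigma>" and ?D = "cherednik b \<iota>"
  \<comment> \<open>\<open>J \<beta> m\<close> is the coefficient of ((1 - x)/2)^m in the Jacobi
    polynomial. At x = 2 tanh^2 t - 1 this power is (1 - tanh^2 t)^m, so it is also the coefficient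
    of \<open>weight (\<sigma> + 2 * of_nat m)\<close>.\<close>
  define J where "J \<beta> m = pochhammer (?\<alpha> + 1) n / fact n *
     (pochhammer (- of_nat n) m * pochhammer (of_nat n + ?\<alpha> + \<beta> + 1) m /
       (pochhammer (?\<alpha> + 1) m * fact m))" for \<beta> m
  define K where "K = pochhammer ((\<sigma> + 1 - of_real \<iota>) / 2)"
  define S where "S = shift_poly (\<sigma> - rho b \<iota>)"
  have K: "K m \<noteq> 0" if "m \<le> n" for m
    using pochhammer_nonzero_le[OF assms(4) that] by (simp add: K_def)
  have jacobi: "weight \<sigma> t * poly (jacobi_poly n ?\<alpha> \<beta>) (of_real (2 * (tanh t)\<^sup>2 - 1)) =
      (\<Sum>m\<le>n. J \<beta> m * weight (\<sigma> + 2 * of_nat m) t)" for \<beta> t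
  proof -
    have "(1 - of_real (2 * (tanh t)\<^sup>2 - 1)) / 2 = (of_real (1 - (tanh t)\<^sup>2) :: complex)"
      by (simp add: field_simps)
    then show ?thesis
      unfolding jacobi_poly_hypergeometric[OF assms(3)] J_def weight_shift
      by (simp only: sum_distrib_left of_real_power mult_ac)
  qed
  show "\<exists>p. poly p = calQ_even b \<iota> \<sigma> n \<and> jacobi_fun_even b \<iota> \<sigma> n = poly_op p ?D (weight \<sigma>)"
    if nz: "pochhammer (\<sigma> / 2) n \<noteq> 0"
  proof -
    \<comment> \<open>Each term divides by the factor that \<open>S m\<close> at D produces from the
      weight; these quotients are exactly the coefficients of the 4F3.\<close>
    define p where "p = (\<Sum>m\<le>n. smult (J (delta0 b \<iota>) m / (pochhammer (\<sigma> / 2) m * K m)) (S m))"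
    have "poly p = calQ_even b \<iota> \<sigma> n"
    proof
      fix x
      show "poly p x = calQ_even b \<iota> \<sigma> n x"
        unfolding p_def calQ_even_def hypergeom_terminating poly_sum sum_distrib_left
        by (intro sum.cong refl) (simp add: S_def poly_shift_poly J_def K_def mult_ac)
    qed
    moreover have "jacobi_fun_even b \<iota> \<sigma> n = poly_op p ?D (weight \<sigma>)"
    proof
      fix t
      show "jacobi_fun_even b \<iota> \<sigma> n t = poly_op p ?D (weight \<sigma>) t"
        unfolding jacobi_fun_even_def jacobi p_def poly_op_sum
        by (intro sum.cong refl)
           (use K pochhammer_nonzero_le[OF nz] in
             \<open>simp add: S_def poly_op_smult poly_op_shift_poly_weight flip: K_def\<close>)
    qed
    ultimately show ?thesis by blast
  qed
  show "\<exists>p. poly p = calQ_odd b \<iota> \<sigma> n \<and> jacobi_fun_odd b \<iota> \<sigma> n = poly_op p ?D (weight \<sigma>)"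
    if nz: "\<sigma> \<noteq> 0 \<and> pochhammer (\<sigma> / 2 + 1) n \<noteq> 0"
  proof -
    \<comment> \<open>The same division, now by the factor that comes with the tanh term.\<close>
    define p where "p = (\<Sum>m\<le>n. smult (J (delta1 b \<iota>) m / (- \<sigma> * pochhammer (\<sigma> / 2 + 1) m * K m))
      ([:rho b \<iota>, 1:] * S m))"
    have "poly p = calQ_odd b \<iota> \<sigma> n"
    proof
      fix x
      show "poly p x = calQ_odd b \<iota> \<sigma> n x"
        unfolding p_def calQ_odd_def hypergeom_terminating poly_sum sum_distrib_left
        by (intro sum.cong refl) (simp add: S_def poly_shift_poly J_def K_def mult_ac del: mult_pCons_left)
    qed
    moreover have "jacobi_fun_odd b \<iota> \<sigma> n = poly_op p ?D (weight \<sigma>)"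
    proof
      fix t
      \<comment> \<open>Both sides equal 2 (\<sigma>/2)_(m+1); this is how the lower parameter
        \<sigma>/2 turns into \<sigma>/2 + 1 and the prefactor -\<sigma> appears.\<close>
      have "(\<sigma> + 2 * of_nat m) * pochhammer (\<sigma> / 2) m = \<sigma> * pochhammer (\<sigma> / 2 + 1) m" for m
        using pochhammer_Suc[of "\<sigma> / 2" m] pochhammer_rec[of "\<sigma> / 2" m]
        by (simp add: field_simps)
      then have "- (\<sigma> + 2 * of_nat m) * pochhammer (\<sigma> / 2) m = - \<sigma> * pochhammer (\<sigma> / 2 + 1) m" for m
        by (simp only: mult_minus_left)
      then have op: "poly_op ([:rho b \<iota>, 1:] * S m) ?D (weight \<sigma>) t =
          - \<sigma> * pochhammer (\<sigma> / 2 + 1) m * K m * (of_real (tanh t) * weight (\<sigma> + 2 * of_nat m) t)" for m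
        unfolding S_def poly_op_rho_shift_poly_weight K_def by (simp only:)
      show "jacobi_fun_odd b \<iota> \<sigma> n t = poly_op p ?D (weight \<sigma>) t"
        unfolding jacobi_fun_odd_def jacobi p_def poly_op_sum poly_op_smult op sum_distrib_right
        by (intro sum.cong refl)
           (use K nz pochhammer_nonzero_le[of "\<sigma> / 2 + 1" n] in simp)
    qed
    ultimately show ?thesis by blast
  qed
qed

end
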